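(* Let $(p_n)_{n\ge 1}$ be a sequence of tearing probabilities in $(0,1)$ such that the limit $\alpha = \lim_{n\to\infty} p_n \log n$ exists. Then the capacity of the torn-paper channel with tearing probabilities $(p_n)$ is $$C = e^{-\alpha}.$$
   Context: Logarithms $\log$ are base 2. The torn-paper channel with block length $n$ and tearing probability $p_n$ is defined as follows. The input is a binary string $X^n=(X_1,\dots,X_n)\in\{0,1\}^n$. Let $T_2,\dots,T_n$ be i.i.d. $\mathrm{Bernoulli}(p_n)$ random variables (independent of the input), $T_i$ indicating a cut between $X_{i-1}$ and $X_i$; equivalently, with $N_1,N_2,\dots$ i.i.d. $\mathrm{Geometric}(p_n)$ (support $\{1,2,\dots\}$, mean $1/p_n$) and $K$ the smallest index with $\sum_{i=1}^K N_i\ge n$, the input is cut into consecutive fragments $\vec X_i = (X_{1+\sum_{j<i}N_j},\dots,X_{\sum_{j\le i}N_j})$ for $i<K$ and $\vec X_K=(X_{1+\sum_{j<K}N_j},\dots,X_n)$. Given $K$, let $\pi$ be a uniformly random permutation of $\{1,\dots,K\}$; the channel output is the unordered collection $\mathcal Y=\{\vec Y_1,\dots,\vec Y_K\}$ with $\vec Y_i=\vec X_{\pi_i}$. A code of rate $R$ consists of $2^{nR}$ binary codewords of length $n$ and a decoder mapping the output collection to an estimate $\hat W\in\{1,\dots,2^{nR}\}$; the message $W$ is uniform on $\{1,\dots,2^{nR}\}$. A rate $R$ is achievable if there is a sequence of rate-$R$ codes with $n\to\infty$ whose error probability $\Pr(\hat W\ne W)$ tends to $0$; the capacity $C$ is the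 supremum of achievable rates. *)

theory Defs
  imports "HOL-Probability.Probability" "HOL-Library.Multiset"
begin

text \<open>Splitting a string into fragments. The input is a list of pairs (symbol, flag),
  where the flag of position i indicates a cut between positions i-1 and i
  (the flag of the first position is ignored).\<close>
fun pieces :: "('a \<times> bool) list \<Rightarrow> 'a list list" where
  "pieces [] = []"
| "pieces [(a, c)] = [[a]]"
| "pieces ((a, c) # (b, d) # rest) =
     (let ps = pieces ((b, d) # rest)
      in if d then [a] # ps else (a # hd ps) # tl ps)"

text \<open>Torn-paper channel with tearing probability q applied to input x:
  cuts T_i (i = 1..length x - 1, cut between x_(i-1) and x_i, 0-based) are i.i.d.
  Bernoulli(q); the output is the unordered collection (multiset) of fragments.\<close>
definition torn_paper :: "real \<Rightarrow> bool list \<Rightarrow> bool list multiset pmf" where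
  "torn_paper q x =
     map_pmf (\<lambda>T. mset (pieces (zip x (map T [0..<length x]))))
       (Pi_pmf {1..<length x} False (\<lambda>_. bernoulli_pmf q))"

definition num_msgs :: "nat \<Rightarrow> real \<Rightarrow> nat" where
  "num_msgs n R = nat \<lceil>2 powr (real n * R)\<rceil>"

definition code_error :: "real \<Rightarrow> nat \<Rightarrow> (nat \<Rightarrow> bool list) \<Rightarrow> (bool list multiset \<Rightarrow> nat) \<Rightarrow> real" where
  "code_error q M enc dec =
     (\<Sum>w<M. measure_pmf.prob (torn_paper q (enc w)) {y. dec y \<noteq> w}) / real M"

definition codes :: "nat \<Rightarrow> nat \<Rightarrow> ((nat \<Rightarrow> bool list) \<times> (bool list multiset \<Rightarrow> nat)) set" where
  "codes n M = {(enc, dec). \<forall>w<M. length (enc w) = n}"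

definition achievable :: "(nat \<Rightarrow> real) \<Rightarrow> real \<Rightarrow> bool" where
  "achievable p R \<longleftrightarrow>
     (\<exists>code :: nat \<Rightarrow> (nat \<Rightarrow> bool list) \<times> (bool list multiset \<Rightarrow> nat).
        (\<forall>n. code n \<in> codes n (num_msgs n R)) \<and>
        (\<lambda>n. code_error (p n) (num_msgs n R) (fst (code n)) (snd (code n))) \<longlonglongrightarrow> 0)"

definition capacity :: "(nat \<Rightarrow> real) \<Rightarrow> real" where
  "capacity p = Sup {R. 0 \<le> R \<and> achievable p R}"

end

theory Submission
  imports Defs "HOL-Library.Log_Nat" "HOL-Real_Asymp.Real_Asymp"
begin

text \<open>
  Let \<open>l\<close> be \<open>log n\<close> rounded up, and let the excess of an output be the sum of
  \<open>max 0 (length s - l)\<close> over its fragments \<open>s\<close>: locating a fragment among \<open>n\<close> positions costs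
  \<open>l\<close> bits, so the excess measures the information that survives. A fragment of length \<open>L\<close>
  contains \<open>max 0 (L - l)\<close> windows of \<open>l + 1\<close> consecutive positions, hence the excess is the
  number of windows without a cut. Its mean is \<open>(n - l) (1 - p_n)^l \<sim> n exp (- \<alpha>)\<close>, and only
  windows at distance less than \<open>l\<close> are correlated, so by Chebyshev's inequality the excess
  divided by \<open>n\<close> tends to \<open>exp (- \<alpha>)\<close> in probability. The same argument with \<open>l = 1\<close> shows that
  there are only \<open>o(n)\<close> fragments, because fragments are non-empty and their number is therefore
  \<open>n\<close> minus the excess for \<open>l = 1\<close>.

  Achievability: if an output has excess \<open>S\<close>, at most \<open>2^(n - S)\<close> words of length \<open>n\<close> contain its
  fragments of length above \<open>l\<close> at disjoint positions. A greedily chosen code of rate below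
  \<open>exp (- \<alpha>)\<close> is therefore decoded by looking for a codeword that contains them.

  Converse: the success probabilities of the messages, restricted to a finite set of outputs, add up
  to at most the size of that set. A generating function over multisets of words shows that only
  \<open>2^((exp (- \<alpha>) + o(1)) n)\<close> outputs have \<open>o(n)\<close> fragments and excess at most
  \<open>(exp (- \<alpha>) + o(1)) n\<close>.
\<close>

section \<open>Fragments and uncut windows\<close>

lemma pieces_eq_Nil_iff [simp]: "pieces zs = [] \<longleftrightarrow> zs = []"
  by (induction zs rule: pieces.induct) (auto simp: Let_def)

lemma concat_pieces: "concat (pieces zs) = map fst zs"
proof (induction zs rule: pieces.induct)
  case (3 a c b d rest)
  then show ?case by (cases "pieces ((b, d) # rest)") (auto simp: Let_def)
qed auto

lemma Nil_notin_pieces: "[] \<notin> set (pieces zs)"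
proof (induction zs rule: pieces.induct)
  case (3 a c b d rest)
  then show ?case by (cases "pieces ((b, d) # rest)") (auto simp: Let_def)
qed auto

lemma less_length_hd_pieces_iff:
  "zs \<noteq> [] \<Longrightarrow> l < length (hd (pieces zs)) \<longleftrightarrow> l < length zs \<and> (\<forall>i<l. \<not> snd (zs ! Suc i))"
proof (induction zs arbitrary: l rule: pieces.induct)
  case (3 a c b d rest)
  show ?case
  proof (cases l)
    case (Suc k)
    then show ?thesis using "3.IH"[of k] by (auto simp: Let_def All_less_Suc2)
  qed (simp add: Let_def)
qed auto

lemma sum_list_length_diff_pieces:
  "(\<Sum>s\<leftarrow>pieces zs. length s - l) =
    (\<Sum>j<length zs - l. of_bool (\<forall>i<l. \<not> snd (zs ! (j + Suc i))))"
proof (induction zs rule: pieces.induct)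
  case (2 a c)
  then show ?case by (cases l) auto
next
  case (3 a c b d rest)
  let ?zs = "(b, d) # rest"
  have first: "(\<Sum>s\<leftarrow>pieces ((a, c) # ?zs). length s - l) =
      of_bool (l < length (hd (pieces ((a, c) # ?zs)))) + (\<Sum>s\<leftarrow>pieces ?zs. length s - l)"
    by (cases "pieces ?zs") (auto simp: Let_def)
  show ?case
  proof (cases "l \<le> length ?zs")
    case True
    then have "length ((a, c) # ?zs) - l = Suc (length ?zs - l)"
      by (simp add: Suc_diff_le)
    moreover have "l < length (hd (pieces ((a, c) # ?zs))) \<longleftrightarrow> (\<forall>i<l. \<not> snd (?zs ! i))"
      using True by (subst less_length_hd_pieces_iff) auto
    ultimately show ?thesis
      unfolding first "3.IH" by (simp only: sum.lessThan_Suc_shift) simp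
  next
    case False
    then have "\<not> l < length (hd (pieces ((a, c) # ?zs)))"
      by (subst less_length_hd_pieces_iff) auto
    then show ?thesis
      unfolding first "3.IH" using False by simp
  qed
qed simp

definition frags :: "'a list \<Rightarrow> (nat \<Rightarrow> bool) \<Rightarrow> 'a list multiset" where
  "frags x T = mset (pieces (zip x (map T [0..<length x])))"

definition excess :: "nat \<Rightarrow> 'a list multiset \<Rightarrow> nat" where
  "excess l y = (\<Sum>s\<in>#y. length s - l)"

definition uncut_windows :: "nat \<Rightarrow> nat \<Rightarrow> (nat \<Rightarrow> bool) \<Rightarrow> nat" where
  "uncut_windows n l T = card {j \<in> {..<n - l}. \<forall>i\<in>{j<..j + l}. \<not> T i}"

lemma excess_frags: "excess l (frags x T) = uncut_windows (length x) l T"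
proof -
  have window: "(\<forall>i\<in>{j<..j + l}. \<not> T i) \<longleftrightarrow> (\<forall>i<l. \<not> T (j + Suc i))" for j
  proof -
    have "{j<..j + l} = (\<lambda>i. i + Suc j) ` {0..<l}"
      unfolding image_add_atLeastLessThan' by auto
    then show ?thesis by (auto simp: add.commute)
  qed
  have "excess l (frags x T) = (\<Sum>s\<leftarrow>pieces (zip x (map T [0..<length x])). length s - l)"
    by (simp add: excess_def frags_def flip: mset_map sum_mset_sum_list)
  also have "\<dots> = (\<Sum>j<length x - l. of_bool (\<forall>i\<in>{j<..j + l}. \<not> T i))"
    unfolding sum_list_length_diff_pieces window by (intro sum.cong) auto
  finally show ?thesis by (simp add: uncut_windows_def Int_def)
qed

lemma obtain_frags_list:
  obtains ss where "mset ss = frags x T" "concat ss = x"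
proof
  show "mset (pieces (zip x (map T [0..<length x]))) = frags x T" by (simp add: frags_def)
qed (simp add: concat_pieces)

lemma Nil_notin_frags: "[] \<notin># frags x T"
  by (simp add: frags_def Nil_notin_pieces)

lemma sum_length_frags: "(\<Sum>s\<in>#frags x T. length s) = length x"
proof -
  obtain ss where "mset ss = frags x T" "concat ss = x" by (rule obtain_frags_list)
  then show ?thesis by (metis length_concat mset_map sum_mset_sum_list)
qed

lemma length_le_if_mem_frags: "s \<in># frags x T \<Longrightarrow> length s \<le> length x"
  using sum_length_frags[of x T] by (auto dest!: multi_member_split)

lemma size_add_excess_1:
  assumes "[] \<notin># y" shows "size y + excess 1 y = (\<Sum>s\<in>#y. length s)"
  using assms
proof (induction y)
  case (add s y)
  then show ?case by (cases s) (auto simp: excess_def)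
qed (simp add: excess_def)

section \<open>Words containing given fragments\<close>

definition embeds :: "'a list multiset \<Rightarrow> 'a list \<Rightarrow> bool" where
  "embeds y x \<longleftrightarrow> (\<exists>ss. concat ss = x \<and> y \<subseteq># mset ss)"

lemma embeds_frags: "y \<subseteq># frags x T \<Longrightarrow> embeds y x"
  unfolding embeds_def using obtain_frags_list[of x T] by metis

lemma embeds_NilD:
  assumes "embeds y []" "[] \<notin># y"
  shows "y = {#}"
proof (rule ccontr)
  assume "y \<noteq> {#}"
  then obtain s where "s \<in># y" by blast
  moreover obtain ss where "concat ss = []" "y \<subseteq># mset ss"
    using assms(1) by (auto simp: embeds_def)
  ultimately show False
    using assms(2) set_mset_mono[of y "mset ss"] by auto
qed

lemma embeds_nonemptyE:
  assumes "embeds y x" "[] \<notin># y"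
  obtains ss where "concat ss = x" "y \<subseteq># mset ss" "[] \<notin> set ss"
proof -
  obtain ss where ss: "concat ss = x" "y \<subseteq># mset ss"
    using assms(1) by (auto simp: embeds_def)
  let ?ss = "filter (\<lambda>s. s \<noteq> []) ss"
  have "concat (filter (\<lambda>s. s \<noteq> []) ts) = concat ts" for ts :: "'a list list"
    by (induction ts) auto
  then have "concat ?ss = x" using ss(1) by simp
  moreover have "filter_mset (\<lambda>s. s \<noteq> []) y = y"
    using assms(2) by (auto simp: filter_mset_eq_conv)
  then have "y \<subseteq># mset ?ss"
    using multiset_filter_mono[OF ss(2), of "\<lambda>s. s \<noteq> []"] by simp
  ultimately show thesis by (rule that) simp
qed

lemma embeds_ConsE:
  assumes "embeds y (a # x)" "[] \<notin># y"
  obtains (free) "embeds y x"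
    | (fragment) s x' where "s \<in># y" "a # x = s @ x'" "embeds (y - {#s#}) x'"
proof -
  obtain ss0 where ss0: "concat ss0 = a # x" "y \<subseteq># mset ss0" "[] \<notin> set ss0"
    using assms by (rule embeds_nonemptyE)
  then obtain s ss where "ss0 = s # ss" by (cases ss0) auto
  with ss0 obtain s' where s: "s = a # s'" "x = s' @ concat ss" and "y \<subseteq># add_mset s (mset ss)"
    by (cases s) auto
  then have sub: "y - {#s#} \<subseteq># mset ss" by (simp add: subset_eq_diff_conv)
  show thesis
  proof (cases "s \<in># y")
    case True
    moreover have "embeds (y - {#s#}) (concat ss)"
      using sub by (auto simp: embeds_def)
    ultimately show thesis
      using s by (intro fragment) auto
  next
    case False
    then have "y \<subseteq># mset ss"
      using sub by (simp add: diff_single_trivial)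
    also have "\<dots> \<subseteq># mset (s' # ss)" by simp
    finally have "embeds y x"
      unfolding embeds_def s(2) by (intro exI[of _ "s' # ss"]) simp
    then show thesis by (rule free)
  qed
qed

definition words_embedding :: "'a list multiset \<Rightarrow> nat \<Rightarrow> 'a list set" where
  "words_embedding y n = {x. length x = n \<and> embeds y x}"

lemma finite_words: "finite {x :: 'a::finite list. length x = n}"
  using finite_lists_length_eq[of "UNIV :: 'a set" n] by simp

lemma finite_words_length_le: "finite {x :: 'a::finite list. length x \<le> n}"
  using finite_lists_length_le[of "UNIV :: 'a set" n] by simp

lemma card_words: "card {x :: 'a::finite list. length x = n} = CARD('a) ^ n"
  using card_lists_length_eq[of "UNIV :: 'a set" n] by simp

lemma finite_words_embedding: "finite (words_embedding y n :: 'a::finite list set)"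
  by (rule finite_subset[OF _ finite_words[of n]]) (auto simp: words_embedding_def)

lemma words_embedding_Suc_subset:
  assumes "[] \<notin># y"
  shows "words_embedding y (Suc n) \<subseteq> (\<lambda>(a, x). a # x) ` (UNIV \<times> words_embedding y n) \<union>
    (\<Union>s\<in>{s \<in> set_mset y. length s \<le> Suc n}. (@) s ` words_embedding (y - {#s#}) (Suc n - length s))"
    (is "_ \<subseteq> ?free \<union> ?fragment")
proof
  fix x assume "x \<in> words_embedding y (Suc n)"
  then obtain a x' where x: "x = a # x'" "length x' = n" and "embeds y (a # x')"
    by (auto simp: words_embedding_def length_Suc_conv)
  from this(3) assms show "x \<in> ?free \<union> ?fragment"
  proof (cases rule: embeds_ConsE)
    case free
    then show ?thesis using x by (auto simp: words_embedding_def)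
  next
    case (fragment s x'')
    then have "length s + length x'' = Suc n"
      using x(2) by (metis length_Cons length_append)
    then have "length s \<le> Suc n" "x'' \<in> words_embedding (y - {#s#}) (Suc n - length s)"
      using fragment by (auto simp: words_embedding_def)
    then show ?thesis using fragment x(1) by auto
  qed
qed

lemma card_words_embedding_Suc_le:
  fixes y :: "'a::finite list multiset"
  assumes "[] \<notin># y"
  shows "card (words_embedding y (Suc n)) \<le> CARD('a) * card (words_embedding y n) +
    (\<Sum>s | s \<in># y \<and> length s \<le> Suc n. card (words_embedding (y - {#s#}) (Suc n - length s)))"
proof -
  let ?free = "(\<lambda>(a, x). a # x) ` (UNIV \<times> words_embedding y n)"
  let ?B = "\<lambda>s. (@) s ` words_embedding (y - {#s#}) (Suc n - length s)"
  let ?I = "{s \<in> set_mset y. length s \<le> Suc n}"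
  have "card (words_embedding y (Suc n)) \<le> card (?free \<union> (\<Union>s\<in>?I. ?B s))"
    by (intro card_mono words_embedding_Suc_subset assms) (simp add: finite_words_embedding)
  also have "\<dots> \<le> card ?free + card (\<Union>s\<in>?I. ?B s)"
    by (rule card_Un_le)
  also have "card ?free \<le> CARD('a) * card (words_embedding y n)"
    using card_image_le[of "UNIV \<times> words_embedding y n" "\<lambda>(a, x). a # x"]
    by (simp add: finite_words_embedding card_cartesian_product)
  also have "card (\<Union>s\<in>?I. ?B s) \<le> (\<Sum>s\<in>?I. card (?B s))"
    by (rule card_UN_le) simp
  also have "\<dots> \<le> (\<Sum>s\<in>?I. card (words_embedding (y - {#s#}) (Suc n - length s)))"
    by (intro sum_mono card_image_le finite_words_embedding)
  finally show ?thesis by simp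
qed

lemma card_words_embedding_0_le:
  assumes "[] \<notin># y"
  shows "card (words_embedding y 0) \<le> of_bool (y = {#})"
proof -
  have "words_embedding y 0 \<subseteq> (if y = {#} then {[]} else {})"
    using assms embeds_NilD by (auto simp: words_embedding_def)
  from card_mono[OF _ this] show ?thesis by (auto split: if_splits)
qed

lemma power_add_linear_term_le: "k ^ n + n * k ^ (n - 1) \<le> Suc k ^ n"
proof (induction n)
  case (Suc n)
  have "k ^ Suc n + Suc n * k ^ n \<le> (k ^ n + n * k ^ (n - 1)) * Suc k"
    by (cases n) (auto simp: algebra_simps)
  also have "\<dots> \<le> Suc k ^ n * Suc k"
    by (intro mult_right_mono Suc.IH) simp
  finally show ?case by (simp add: mult.commute)
qed simp

lemma card_set_mset_le_size: "card (set_mset y) \<le> size y"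
  by (induction y) (auto simp: card_insert_if)

lemma card_words_embedding_le_step:
  fixes y :: "'a::finite list multiset" and n N :: nat
  assumes "[] \<notin># y"
    and free: "card (words_embedding y n) * N \<le> n ^ size y * CARD('a) ^ n"
    and fragment: "\<And>s. s \<in># y \<Longrightarrow> length s \<le> Suc n \<Longrightarrow>
      card (words_embedding (y - {#s#}) (Suc n - length s)) * N \<le>
        n ^ (size y - 1) * CARD('a) ^ Suc n"
  shows "card (words_embedding y (Suc n)) * N \<le> Suc n ^ size y * CARD('a) ^ Suc n"
proof -
  let ?q = "CARD('a)" and ?I = "{s. s \<in># y \<and> length s \<le> Suc n}"
  have "card (words_embedding y (Suc n)) * N \<le> ?q * (card (words_embedding y n) * N) +
      (\<Sum>s\<in>?I. card (words_embedding (y - {#s#}) (Suc n - length s)) * N)"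
    using mult_right_mono[OF card_words_embedding_Suc_le[OF assms(1), of n], of N]
    by (simp add: algebra_simps sum_distrib_left)
  also have "\<dots> \<le> ?q * (n ^ size y * ?q ^ n) + (\<Sum>s\<in>?I. n ^ (size y - 1) * ?q ^ Suc n)"
    by (intro add_mono mult_left_mono sum_mono free fragment) auto
  also have "\<dots> = (n ^ size y + card ?I * n ^ (size y - 1)) * ?q ^ Suc n"
    by (simp add: algebra_simps)
  also have "\<dots> \<le> (n ^ size y + size y * n ^ (size y - 1)) * ?q ^ Suc n"
    by (intro mult_right_mono add_left_mono order_trans[OF card_mono card_set_mset_le_size]) auto
  also have "\<dots> \<le> Suc n ^ size y * ?q ^ Suc n"
    by (intro mult_right_mono power_add_linear_term_le) simp
  finally show ?thesis .
qed

lemma card_words_embedding_le: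
  fixes y :: "'a::finite list multiset"
  assumes "[] \<notin># y"
  shows "card (words_embedding y n) * CARD('a) ^ (\<Sum>s\<in>#y. length s) \<le> n ^ size y * CARD('a) ^ n"
  using assms
proof (induction n arbitrary: y rule: less_induct)
  case (less n)
  let ?q = "CARD('a)" and ?L = "\<lambda>y :: 'a list multiset. \<Sum>s\<in>#y. length s"
  show ?case
  proof (cases n)
    case 0
    show ?thesis
      using card_words_embedding_0_le[OF less.prems] 0 by (cases "y = {#}") auto
  next
    case (Suc k)
    have "card (words_embedding y (Suc k)) * ?q ^ ?L y \<le> Suc k ^ size y * ?q ^ Suc k"
    proof (rule card_words_embedding_le_step[OF less.prems])
      show "card (words_embedding y k) * ?q ^ ?L y \<le> k ^ size y * ?q ^ k"
        using less.IH[of k y] less.prems Suc by simp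
    next
      fix s assume "s \<in># y" and s: "length s \<le> Suc k"
      then obtain z where y: "y = add_mset s z" by (auto dest: multi_member_split)
      then have "0 < length s" using less.prems by auto
      then have shorter: "Suc k - length s < n" "Suc k - length s \<le> k" using Suc by linarith+
      have "card (words_embedding (y - {#s#}) (Suc k - length s)) * ?q ^ ?L y =
          card (words_embedding z (Suc k - length s)) * ?q ^ ?L z * ?q ^ length s"
        by (simp add: y power_add mult_ac)
      also have "\<dots> \<le> (Suc k - length s) ^ size z * ?q ^ (Suc k - length s) * ?q ^ length s"
        using less.prems shorter y by (intro mult_right_mono less.IH) auto
      also have "\<dots> = (Suc k - length s) ^ size z * ?q ^ Suc k"
        using s by (simp add: mult.assoc flip: power_add)
      also have "\<dots> \<le> k ^ size z * ?q ^ Suc k"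
        using shorter by (intro mult_right_mono power_mono) auto
      finally show "card (words_embedding (y - {#s#}) (Suc k - length s)) * ?q ^ ?L y \<le>
          k ^ (size y - 1) * ?q ^ Suc k"
        by (simp add: y)
    qed
    then show ?thesis using Suc by simp
  qed
qed

lemma card_words_embedding_long_le:
  fixes y :: "'a::finite list multiset"
  assumes "n \<le> CARD('a) ^ l"
  shows "card (words_embedding {#s \<in># y. l < length s#} n) * CARD('a) ^ excess l y \<le> CARD('a) ^ n"
proof -
  let ?q = "CARD('a)" and ?y = "{#s \<in># y. l < length s#}"
  have "(\<Sum>s\<in>#?y. length s) = l * size ?y + excess l y"
    unfolding excess_def by (induction y) auto
  then have "card (words_embedding ?y n) * ?q ^ (l * size ?y + excess l y) \<le> n ^ size ?y * ?q ^ n"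
    using card_words_embedding_le[of ?y n] by simp
  also have "\<dots> \<le> (?q ^ l) ^ size ?y * ?q ^ n"
    by (intro mult_right_mono power_mono assms) auto
  finally have "card (words_embedding ?y n) * ?q ^ excess l y * ?q ^ (l * size ?y) \<le>
      ?q ^ n * ?q ^ (l * size ?y)"
    by (simp add: power_add power_mult mult_ac)
  then show ?thesis by simp
qed

section \<open>Codes for general channels\<close>

lemma sum_prob_le:
  fixes D :: "'y pmf"
  assumes "finite I" and "\<And>y. y \<in> set_pmf D \<Longrightarrow> real (card {i \<in> I. P i y}) \<le> B"
  shows "(\<Sum>i\<in>I. measure_pmf.prob D {y. P i y}) \<le> B"
proof -
  have "(\<Sum>i\<in>I. measure_pmf.prob D {y. P i y}) =
      measure_pmf.expectation D (\<lambda>y. \<Sum>i\<in>I. indicator {y. P i y} y)"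
    by (subst Bochner_Integration.integral_sum)
      (auto intro!: measure_pmf.integrable_const_bound[where B = 1])
  also have "\<dots> = measure_pmf.expectation D (\<lambda>y. real (card {i \<in> I. P i y}))"
    using assms(1) by (simp add: indicator_def Int_def)
  also have "\<dots> \<le> B"
  proof (rule measure_pmf.integral_le_const)
    show "integrable D (\<lambda>y. real (card {i \<in> I. P i y}))"
      using assms(1)
      by (intro measure_pmf.integrable_const_bound[where B = "real (card I)"])
         (auto intro!: AE_pmfI card_mono)
    show "AE y in D. real (card {i \<in> I. P i y}) \<le> B"
      by (intro AE_pmfI assms)
  qed
  finally show ?thesis .
qed

lemma greedy_codebook_exists:
  fixes g :: "'x \<Rightarrow> 'x \<Rightarrow> real"
  assumes X: "finite X" "X \<noteq> {}"
    and avg: "\<And>x. x \<in> X \<Longrightarrow> (\<Sum>x'\<in>X. g x x') \<le> e * real (card X)"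
  shows "\<exists>f :: nat \<Rightarrow> 'x. \<forall>w. f w \<in> X \<and> (\<Sum>v<w. g (f v) (f w)) \<le> real w * e"
proof (rule dependent_wellorder_choice)
  fix f w
  assume f: "\<And>v. v < w \<Longrightarrow> f v \<in> X \<and> (\<Sum>u<v. g (f u) (f v)) \<le> real v * e"
  show "\<exists>x. x \<in> X \<and> (\<Sum>v<w. g (f v) x) \<le> real w * e"
  proof (rule ccontr)
    assume "\<not> ?thesis"
    then have "(\<Sum>x\<in>X. real w * e) < (\<Sum>x\<in>X. \<Sum>v<w. g (f v) x)"
      using X by (intro sum_strict_mono) auto
    also have "\<dots> = (\<Sum>v<w. \<Sum>x\<in>X. g (f v) x)" by (rule sum.swap)
    also have "\<dots> \<le> (\<Sum>v<w. e * real (card X))" using f by (intro sum_mono avg) auto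
    finally show False by simp
  qed
qed simp

lemma sum_strict_triangle_swap:
  "(\<Sum>v<n. \<Sum>w\<in>{v<..<n}. h v w) = (\<Sum>w<n. \<Sum>v<w. h v w)" for n :: nat
  by (simp add: sum.Sigma) (rule sum.reindex_bij_witness[of _ prod.swap prod.swap], auto)

text \<open>The greedy choice only controls how often a codeword is confused with a later one. Decoding to
  the last consistent message makes these confusions the only errors.\<close>
definition last_consistent :: "(nat \<Rightarrow> 'y \<Rightarrow> bool) \<Rightarrow> nat \<Rightarrow> 'y \<Rightarrow> nat" where
  "last_consistent C M y = (GREATEST w. w < M \<and> C w y)"

lemma last_consistent_properties:
  assumes "w < M" "C w y"
  shows "last_consistent C M y < M" "C (last_consistent C M y) y" "w \<le> last_consistent C M y"
  using GreatestI_nat[of "\<lambda>w. w < M \<and> C w y" w M] Greatest_le_nat[of "\<lambda>w. w < M \<and> C w y" w M] assms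
  unfolding last_consistent_def by auto

lemma prob_last_consistent_neq_le:
  fixes D :: "'y pmf"
  assumes "w < M" and "\<And>y. y \<in> set_pmf D \<Longrightarrow> C w y"
  shows "measure_pmf.prob D {y. last_consistent C M y \<noteq> w} \<le>
    measure_pmf.prob D (- G) + (\<Sum>w'\<in>{w<..<M}. measure_pmf.prob D {y \<in> G. C w' y})"
proof -
  let ?confused = "\<Union>w'\<in>{w<..<M}. {y \<in> G. C w' y}"
  have "y \<in> - G \<union> ?confused" if "y \<in> set_pmf D" "last_consistent C M y \<noteq> w" for y
    using last_consistent_properties[of w M C y] assms that by force
  then have "measure_pmf.prob D {y. last_consistent C M y \<noteq> w} \<le>
      measure_pmf.prob D (- G \<union> ?confused)"
    by (intro measure_pmf.finite_measure_mono_AE AE_pmfI) auto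
  also have "\<dots> \<le> measure_pmf.prob D (- G) + measure_pmf.prob D ?confused"
    by (rule measure_Un_le) auto
  also have "measure_pmf.prob D ?confused \<le> (\<Sum>w'\<in>{w<..<M}. measure_pmf.prob D {y \<in> G. C w' y})"
    by (intro measure_pmf.finite_measure_subadditive_finite) auto
  finally show ?thesis by simp
qed

lemma packing_bound:
  fixes W :: "'x \<Rightarrow> 'y pmf"
  assumes X: "finite X" "X \<noteq> {}" and "0 \<le> e"
    and consistent: "\<And>x y. x \<in> X \<Longrightarrow> y \<in> set_pmf (W x) \<Longrightarrow> C x y"
    and few: "\<And>y. y \<in> G \<Longrightarrow> real (card {x \<in> X. C x y}) \<le> e * real (card X)"
    and typical: "\<And>x. x \<in> X \<Longrightarrow> measure_pmf.prob (W x) (- G) \<le> \<eta>"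
  shows "\<exists>f dec. range f \<subseteq> X \<and>
    (\<Sum>w<M. measure_pmf.prob (W (f w)) {y. dec y \<noteq> w}) \<le> real M * (\<eta> + real M * e)"
proof -
  define g where "g x x' = measure_pmf.prob (W x) {y \<in> G. C x' y}" for x x'
  have "(\<Sum>x'\<in>X. g x x') \<le> e * real (card X)" for x
    unfolding g_def
  proof (rule sum_prob_le[OF X(1)])
    show "real (card {x' \<in> X. y \<in> G \<and> C x' y}) \<le> e * real (card X)" for y
      using few \<open>0 \<le> e\<close> by (cases "y \<in> G") auto
  qed
  then obtain f where f: "\<And>w :: nat. f w \<in> X" and g: "\<And>w. (\<Sum>v<w. g (f v) (f w)) \<le> real w * e"
    using greedy_codebook_exists[OF X, of g e] by blast
  define dec where "dec = last_consistent (\<lambda>w. C (f w)) M"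
  have "(\<Sum>w<M. measure_pmf.prob (W (f w)) {y. dec y \<noteq> w}) \<le>
      (\<Sum>w<M. measure_pmf.prob (W (f w)) (- G) + (\<Sum>w'\<in>{w<..<M}. g (f w) (f w')))"
    unfolding dec_def g_def
    by (intro sum_mono prob_last_consistent_neq_le consistent f) auto
  also have "\<dots> = (\<Sum>w<M. measure_pmf.prob (W (f w)) (- G)) + (\<Sum>w'<M. \<Sum>w<w'. g (f w) (f w'))"
    by (simp add: sum.distrib sum_strict_triangle_swap)
  also have "\<dots> \<le> (\<Sum>w<M. \<eta>) + (\<Sum>w'<M. real M * e)"
    using \<open>0 \<le> e\<close> by (intro add_mono sum_mono typical f order_trans[OF g] mult_right_mono) auto
  finally show ?thesis
    using f by (intro exI[of _ f] exI[of _ dec]) (auto simp: algebra_simps)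
qed

lemma sum_prob_decoded_le_card:
  fixes W :: "'w \<Rightarrow> 'y pmf" and dec :: "'y \<Rightarrow> 'w"
  assumes "finite I" "finite Y"
  shows "(\<Sum>w\<in>I. measure_pmf.prob (W w) {y \<in> Y. dec y = w}) \<le> real (card Y)"
proof -
  have "(\<Sum>w\<in>I. measure_pmf.prob (W w) {y \<in> Y. dec y = w}) =
      (\<Sum>w\<in>I. \<Sum>y | y \<in> Y \<and> dec y = w. pmf (W w) y)"
    using assms(2) by (simp add: measure_measure_pmf_finite)
  also have "\<dots> \<le> (\<Sum>w\<in>I. \<Sum>y | y \<in> Y \<and> dec y = w. 1)"
    by (intro sum_mono pmf_le_1)
  also have "\<dots> = real (card (\<Union>w\<in>I. {y \<in> Y. dec y = w}))"
    using assms by (subst card_UN_disjoint) auto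
  also have "\<dots> \<le> real (card Y)"
    using assms(2) by (intro of_nat_mono card_mono) auto
  finally show ?thesis .
qed

section \<open>Coding bounds for the torn-paper channel\<close>

definition cuts_pmf :: "nat \<Rightarrow> real \<Rightarrow> (nat \<Rightarrow> bool) pmf" where
  "cuts_pmf n q = Pi_pmf {1..<n} False (\<lambda>_. bernoulli_pmf q)"

definition uncut_windows_pmf :: "nat \<Rightarrow> nat \<Rightarrow> real \<Rightarrow> nat pmf" where
  "uncut_windows_pmf n l q = map_pmf (uncut_windows n l) (cuts_pmf n q)"

lemma torn_paper_eq: "torn_paper q x = map_pmf (frags x) (cuts_pmf (length x) q)"
  by (simp add: torn_paper_def cuts_pmf_def frags_def[abs_def])

lemma set_pmf_torn_paper_subset: "set_pmf (torn_paper q x) \<subseteq> range (frags x)"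
  by (auto simp: torn_paper_eq)

lemma map_excess_torn_paper:
  "map_pmf (excess l) (torn_paper q x) = uncut_windows_pmf (length x) l q"
  by (simp add: torn_paper_eq uncut_windows_pmf_def pmf.map_comp comp_def excess_frags)

lemma prob_excess_torn_paper:
  "measure_pmf.prob (torn_paper q x) {y. P (excess l y)} =
    measure_pmf.prob (uncut_windows_pmf (length x) l q) {k. P k}"
  unfolding map_excess_torn_paper[symmetric] measure_map_pmf by (simp add: vimage_def)

definition window_deviation :: "nat \<Rightarrow> nat \<Rightarrow> real \<Rightarrow> real \<Rightarrow> real \<Rightarrow> real" where
  "window_deviation n l q c \<delta> =
    measure_pmf.prob (uncut_windows_pmf n l q) {k. \<delta> * real n \<le> \<bar>real k - c * real n\<bar>}"

lemma prob_uncut_windows_le_deviation: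
  assumes "\<And>k. P k \<Longrightarrow> \<delta> * real n \<le> \<bar>real k - c * real n\<bar>"
  shows "measure_pmf.prob (uncut_windows_pmf n l q) {k. P k} \<le> window_deviation n l q c \<delta>"
  unfolding window_deviation_def using assms
  by (intro measure_pmf.finite_measure_mono) auto

lemma two_powr_le_num_msgs: "2 powr (real n * R) \<le> real (num_msgs n R)"
  unfolding num_msgs_def by linarith

lemma num_msgs_pos: "0 < num_msgs n R"
  using less_le_trans[OF _ two_powr_le_num_msgs[of n R], of 0] by simp

lemma num_msgs_le:
  assumes "0 \<le> R"
  shows "real (num_msgs n R) \<le> 2 * 2 powr (real n * R)"
proof -
  have "1 \<le> 2 powr (real n * R)" using assms by (simp add: ge_one_powr_ge_zero)
  then show ?thesis unfolding num_msgs_def by linarith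
qed

lemma good_code_exists:
  assumes "n \<le> 2 ^ l"
  shows "\<exists>c\<in>codes n M. code_error q M (fst c) (snd c) \<le>
    measure_pmf.prob (uncut_windows_pmf n l q) {k. real k < b} + real M * 2 powr (- b)"
proof -
  let ?X = "{x :: bool list. length x = n}"
  let ?C = "\<lambda>x y. embeds {#s \<in># y. l < length s#} x"
  let ?\<eta> = "measure_pmf.prob (uncut_windows_pmf n l q) {k. real k < b}"
  have "\<exists>f dec. range f \<subseteq> ?X \<and>
      (\<Sum>w<M. measure_pmf.prob (torn_paper q (f w)) {y. dec y \<noteq> w}) \<le>
        real M * (?\<eta> + real M * 2 powr (- b))"
  proof (rule packing_bound[where C = ?C and G = "{y. b \<le> real (excess l y)}"])
    show "?X \<noteq> {}" using Ex_list_of_length[of n] by auto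
    show "?C x y" if "y \<in> set_pmf (torn_paper q x)" for x y
      using that set_pmf_torn_paper_subset[of q x]
      by (auto intro!: embeds_frags[OF multiset_filter_subset])
    show "measure_pmf.prob (torn_paper q x) (- {y. b \<le> real (excess l y)}) \<le> ?\<eta>" if "x \<in> ?X" for x
      using that prob_excess_torn_paper[of q x "\<lambda>k. real k < b" l]
      by (simp add: Collect_neg_eq[symmetric] not_le)
    show "real (card {x \<in> ?X. ?C x y}) \<le> 2 powr (- b) * real (card ?X)"
      if "y \<in> {y. b \<le> real (excess l y)}" for y
    proof -
      have "real (card {x \<in> ?X. ?C x y}) * 2 powr b \<le> real (card {x \<in> ?X. ?C x y}) * 2 ^ excess l y"
        using that by (intro mult_left_mono) (simp_all flip: powr_realpow)
      also have "\<dots> \<le> 2 ^ n"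
        using of_nat_mono[OF card_words_embedding_long_le[of n l y], where 'a = real] assms
        by (simp add: words_embedding_def)
      finally show ?thesis by (simp add: card_words powr_minus field_simps)
    qed
  qed (simp_all add: finite_words)
  then obtain f dec where f: "range f \<subseteq> ?X"
    and "(\<Sum>w<M. measure_pmf.prob (torn_paper q (f w)) {y. dec y \<noteq> w}) \<le>
        real M * (?\<eta> + real M * 2 powr (- b))"
    by blast
  then have "code_error q M f dec \<le> ?\<eta> + real M * 2 powr (- b)"
    by (cases "M = 0") (auto simp: code_error_def field_simps)
  moreover have "(f, dec) \<in> codes n M" using f by (auto simp: codes_def)
  ultimately show ?thesis by force
qed

lemma good_code_of_rate_exists:
  assumes "n \<le> 2 ^ l" "0 \<le> R" "R + 2 * \<delta> \<le> c"
  shows "\<exists>code\<in>codes n (num_msgs n R). code_error q (num_msgs n R) (fst code) (snd code) \<le>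
    window_deviation n l q c \<delta> + 2 * 2 powr (- \<delta> * real n)"
proof -
  define b where "b = (R + \<delta>) * real n"
  have "b \<le> (c - \<delta>) * real n"
    unfolding b_def using assms(3) by (intro mult_right_mono) auto
  then have few_windows: "measure_pmf.prob (uncut_windows_pmf n l q) {k. real k < b} \<le>
      window_deviation n l q c \<delta>"
    by (intro prob_uncut_windows_le_deviation) (simp add: left_diff_distrib)
  have "real (num_msgs n R) * 2 powr (- b) \<le> 2 * 2 powr (real n * R) * 2 powr (- b)"
    by (intro mult_right_mono num_msgs_le assms) simp
  also have "\<dots> = 2 * 2 powr (- \<delta> * real n)"
    by (simp add: b_def algebra_simps flip: powr_add)
  finally show ?thesis
    using good_code_exists[OF assms(1), of "num_msgs n R" q b] few_windows by force
qed

definition typical_outputs :: "nat \<Rightarrow> nat \<Rightarrow> real \<Rightarrow> real \<Rightarrow> bool list multiset set" where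
  "typical_outputs n l a b =
    {y. (\<forall>s\<in>#y. length s \<le> n) \<and> real (size y) \<le> a \<and> real (excess l y) \<le> b}"

lemma finite_typical_outputs: "finite (typical_outputs n l a b)"
proof (rule finite_subset)
  let ?A = "{s :: bool list. length s \<le> n}"
  show "typical_outputs n l a b \<subseteq> mset ` {ss. set ss \<subseteq> ?A \<and> length ss \<le> nat \<lfloor>a\<rfloor>}"
  proof
    fix y assume y: "y \<in> typical_outputs n l a b"
    obtain ss where ss: "mset ss = y" using ex_mset by blast
    then have "set ss \<subseteq> ?A" "length ss \<le> nat \<lfloor>a\<rfloor>"
      using y by (auto simp: typical_outputs_def le_nat_floor)
    then show "y \<in> mset ` {ss. set ss \<subseteq> ?A \<and> length ss \<le> nat \<lfloor>a\<rfloor>}" using ss by auto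
  qed
  show "finite (mset ` {ss. set ss \<subseteq> ?A \<and> length ss \<le> nat \<lfloor>a\<rfloor>})"
    by (intro finite_imageI finite_lists_length_le finite_words_length_le)
qed

lemma frags_in_typical_outputs_iff:
  "frags x T \<in> typical_outputs (length x) l a b \<longleftrightarrow>
    real (length x) - real (excess 1 (frags x T)) \<le> a \<and> real (excess l (frags x T)) \<le> b"
proof -
  have "real (size (frags x T)) = real (length x) - real (excess 1 (frags x T))"
    using size_add_excess_1[OF Nil_notin_frags[of x T]] sum_length_frags[of x T]
    by (simp flip: of_nat_add)
  then show ?thesis by (auto simp: typical_outputs_def length_le_if_mem_frags)
qed

lemma prob_not_typical_outputs_le:
  assumes "length x = n"
  shows "measure_pmf.prob (torn_paper q x) (- typical_outputs n l a b) \<le>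
    measure_pmf.prob (uncut_windows_pmf n 1 q) {k. a < real n - real k} +
    measure_pmf.prob (uncut_windows_pmf n l q) {k. b < real k}"
proof -
  let ?P = "measure_pmf.prob (torn_paper q x)"
  have "?P (- typical_outputs n l a b) \<le>
      ?P ({y. a < real n - real (excess 1 y)} \<union> {y. b < real (excess l y)})"
  proof (intro measure_pmf.finite_measure_mono_AE AE_pmfI impI)
    fix y assume "y \<in> set_pmf (torn_paper q x)" "y \<in> - typical_outputs n l a b"
    then show "y \<in> {y. a < real n - real (excess 1 y)} \<union> {y. b < real (excess l y)}"
      using set_pmf_torn_paper_subset[of q x] assms by (auto simp: frags_in_typical_outputs_iff)
  qed simp
  also have "\<dots> \<le> ?P {y. a < real n - real (excess 1 y)} + ?P {y. b < real (excess l y)}"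
    by (rule measure_Un_le) auto
  finally show ?thesis
    using prob_excess_torn_paper[of q x "\<lambda>k. a < real n - real k" 1]
      prob_excess_torn_paper[of q x "\<lambda>k. b < real k" l] assms by simp
qed

lemma converse_bound:
  assumes code: "code \<in> codes n M" and "0 < M"
  shows "1 - code_error q M (fst code) (snd code) \<le>
    measure_pmf.prob (uncut_windows_pmf n 1 q) {k. a < real n - real k} +
    measure_pmf.prob (uncut_windows_pmf n l q) {k. b < real k} +
    real (card (typical_outputs n l a b)) / real M"
    (is "_ \<le> ?\<eta> + _")
proof -
  obtain f dec where code_eq: "code = (f, dec)" by fastforce
  let ?P = "\<lambda>w. measure_pmf.prob (torn_paper q (f w))" and ?Y = "typical_outputs n l a b"
  have correct: "1 - ?P w {y. dec y \<noteq> w} \<le> ?\<eta> + ?P w {y \<in> ?Y. dec y = w}" if "w < M" for w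
  proof -
    have "1 - ?P w {y. dec y \<noteq> w} = ?P w {y. dec y = w}"
      using measure_pmf.prob_compl[of "{y. dec y \<noteq> w}" "torn_paper q (f w)"]
      by (simp add: Compl_eq_Diff_UNIV[symmetric] Collect_neg_eq[symmetric])
    also have "\<dots> \<le> ?P w (- ?Y \<union> {y \<in> ?Y. dec y = w})"
      by (intro measure_pmf.finite_measure_mono) auto
    also have "\<dots> \<le> ?P w (- ?Y) + ?P w {y \<in> ?Y. dec y = w}"
      by (rule measure_Un_le) auto
    also have "?P w (- ?Y) \<le> ?\<eta>"
      using code that by (intro prob_not_typical_outputs_le) (auto simp: codes_def code_eq)
    finally show ?thesis by simp
  qed
  have "real M - (\<Sum>w<M. ?P w {y. dec y \<noteq> w}) = (\<Sum>w<M. 1 - ?P w {y. dec y \<noteq> w})"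
    by (simp add: sum_subtractf)
  also have "\<dots> \<le> (\<Sum>w<M. ?\<eta> + ?P w {y \<in> ?Y. dec y = w})"
    by (intro sum_mono correct) simp
  also have "\<dots> \<le> real M * ?\<eta> + real (card ?Y)"
    using sum_prob_decoded_le_card[OF _ finite_typical_outputs, of "{..<M}"]
    by (simp add: sum.distrib)
  finally have "(real M - (\<Sum>w<M. ?P w {y. dec y \<noteq> w})) / real M \<le>
      (real M * ?\<eta> + real (card ?Y)) / real M"
    by (rule divide_right_mono) simp
  then show ?thesis
    using \<open>0 < M\<close> by (simp add: code_error_def code_eq add_divide_distrib diff_divide_distrib)
qed

lemma converse_bound_of_rate:
  assumes "code \<in> codes n (num_msgs n R)"
  shows "1 - code_error q (num_msgs n R) (fst code) (snd code) \<le>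
    window_deviation n 1 q 1 \<delta> + window_deviation n l q c \<delta> +
    real (card (typical_outputs n l (\<delta> * real n) ((c + \<delta>) * real n))) / 2 powr (real n * R)"
proof -
  let ?P = "\<lambda>l. measure_pmf.prob (uncut_windows_pmf n l q)"
  let ?count = "real (card (typical_outputs n l (\<delta> * real n) ((c + \<delta>) * real n)))"
  have "1 - code_error q (num_msgs n R) (fst code) (snd code) \<le>
      ?P 1 {k. \<delta> * real n < real n - real k} + ?P l {k. (c + \<delta>) * real n < real k} +
      ?count / real (num_msgs n R)"
    by (intro converse_bound assms num_msgs_pos)
  also have "\<dots> \<le> window_deviation n 1 q 1 \<delta> + window_deviation n l q c \<delta> +
      ?count / 2 powr (real n * R)"
    by (intro add_mono prob_uncut_windows_le_deviation divide_left_mono two_powr_le_num_msgs)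
      (auto simp: algebra_simps num_msgs_pos)
  finally show ?thesis .
qed

section \<open>Counting typical outputs\<close>

lemma sum_power_le:
  fixes u :: real
  assumes "0 \<le> u" "u < 1"
  shows "(\<Sum>k<n. u ^ k) \<le> 1 / (1 - u)"
  using sum_le_suminf[of "\<lambda>k. u ^ k" "{..<n}"] assms
  by (simp add: summable_geometric suminf_geometric)

lemma inverse_one_minus_le_exp:
  fixes u :: real
  assumes "0 \<le> u" "u \<le> 1 / 2"
  shows "1 / (1 - u) \<le> exp (2 * u)"
proof -
  have "1 \<le> (1 + 2 * u) * (1 - u)"
    using mult_nonneg_nonneg[of u "1 - 2 * u"] assms by (simp add: algebra_simps)
  then have "1 / (1 - u) \<le> 1 + 2 * u"
    using assms by (simp add: field_simps)
  also have "\<dots> \<le> exp (2 * u)" by (rule exp_ge_add_one_self)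
  finally show ?thesis .
qed

lemma prod_mset_image_eq_prod_count:
  fixes w :: "'a \<Rightarrow> 'b::comm_monoid_mult"
  assumes "finite A" "set_mset y \<subseteq> A"
  shows "(\<Prod>a\<in>#y. w a) = (\<Prod>a\<in>A. w a ^ count y a)"
  unfolding image_prod_mset_multiplicity
  by (rule prod.mono_neutral_left) (use assms in \<open>auto simp: not_in_iff\<close>)

lemma sum_prod_mset_le:
  fixes w :: "'a \<Rightarrow> real"
  assumes "finite A" and bounds: "\<And>a. a \<in> A \<Longrightarrow> 0 \<le> w a" "\<And>a. a \<in> A \<Longrightarrow> w a < 1"
    and "finite Y" and support: "\<And>y. y \<in> Y \<Longrightarrow> set_mset y \<subseteq> A"
  shows "(\<Sum>y\<in>Y. \<Prod>a\<in>#y. w a) \<le> (\<Prod>a\<in>A. 1 / (1 - w a))"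
proof -
  let ?c = "\<lambda>y. restrict (count y) A"
  obtain N where N: "(\<Union>y\<in>Y. count y ` A) \<subseteq> {..<N}"
    using finite_nat_iff_bounded[of "\<Union>y\<in>Y. count y ` A"] assms by auto
  have inj: "inj_on ?c Y"
  proof (rule inj_onI, rule multiset_eqI)
    fix y z a assume "y \<in> Y" "z \<in> Y" "?c y = ?c z"
    show "count y a = count z a"
    proof (cases "a \<in> A")
      case True
      then show ?thesis using \<open>?c y = ?c z\<close> by (metis restrict_apply')
    next
      case False
      then show ?thesis using support \<open>y \<in> Y\<close> \<open>z \<in> Y\<close> by (metis not_in_iff subsetD)
    qed
  qed
  have "(\<Sum>y\<in>Y. \<Prod>a\<in>#y. w a) = (\<Sum>y\<in>Y. \<Prod>a\<in>A. w a ^ ?c y a)"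
    using \<open>finite A\<close> support by (intro sum.cong) (auto simp: prod_mset_image_eq_prod_count)
  also have "\<dots> = (\<Sum>m\<in>?c ` Y. \<Prod>a\<in>A. w a ^ m a)"
    by (simp only: sum.reindex[OF inj] comp_def)
  also have "\<dots> \<le> (\<Sum>m\<in>PiE A (\<lambda>_. {..<N}). \<Prod>a\<in>A. w a ^ m a)"
    using \<open>finite A\<close> bounds N
    by (intro sum_mono2 finite_PiE prod_nonneg) (auto simp: UN_subset_iff image_subset_iff)
  also have "\<dots> = (\<Prod>a\<in>A. \<Sum>k<N. w a ^ k)"
    using \<open>finite A\<close> by (simp add: prod_sum_PiE)
  also have "\<dots> \<le> (\<Prod>a\<in>A. 1 / (1 - w a))"
    using bounds by (intro prod_mono conjI sum_power_le sum_nonneg) auto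
  finally show ?thesis .
qed

lemma sum_prod_mset_le_exp:
  fixes w :: "'a \<Rightarrow> real"
  assumes "finite A" and bounds: "\<And>a. a \<in> A \<Longrightarrow> 0 \<le> w a" "\<And>a. a \<in> A \<Longrightarrow> w a \<le> 1 / 2"
    and "finite Y" "\<And>y. y \<in> Y \<Longrightarrow> set_mset y \<subseteq> A"
  shows "(\<Sum>y\<in>Y. \<Prod>a\<in>#y. w a) \<le> exp (2 * (\<Sum>a\<in>A. w a))"
proof -
  have "(\<Sum>y\<in>Y. \<Prod>a\<in>#y. w a) \<le> (\<Prod>a\<in>A. 1 / (1 - w a))"
    using assms by (intro sum_prod_mset_le) force+
  also have "\<dots> \<le> (\<Prod>a\<in>A. exp (2 * w a))"
    using bounds by (intro prod_mono conjI inverse_one_minus_le_exp) force+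
  also have "\<dots> = exp (2 * (\<Sum>a\<in>A. w a))"
    by (simp add: exp_sum[OF \<open>finite A\<close>] sum_distrib_left)
  finally show ?thesis .
qed

lemma sum_words_length_le_eq:
  fixes h :: "nat \<Rightarrow> real"
  shows "(\<Sum>s | length (s :: 'a::finite list) \<le> n. h (length s)) = (\<Sum>L\<le>n. real CARD('a) ^ L * h L)"
proof -
  have "{s :: 'a list. length s \<le> n} = (\<Union>L\<le>n. {s. length s = L})" by auto
  then have "(\<Sum>s | length (s :: 'a list) \<le> n. h (length s)) =
      (\<Sum>L\<le>n. \<Sum>s | length (s :: 'a list) = L. h (length s))"
    by (simp only:) (rule sum.UNION_disjoint, auto simp: finite_words)
  then show ?thesis by (simp add: card_words)
qed

lemma sum_fragment_weights_le:
  fixes r :: real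
  assumes r: "0 < r" "r < 1 / 2"
  shows "(\<Sum>s | length (s :: bool list) \<le> n. r ^ (length s - l)) \<le> 2 ^ l * (1 + 1 / (1 - 2 * r))"
proof -
  have split: "(\<Sum>L<l + m. 2 ^ L * r ^ (L - l)) = (2 ^ l - 1) + 2 ^ l * (\<Sum>k<m. (2 * r) ^ k)" for m
    by (induction m) (auto simp: sum_gp_strict power_add power_mult_distrib algebra_simps)
  have "(\<Sum>s | length (s :: bool list) \<le> n. r ^ (length s - l)) = (\<Sum>L\<le>n. 2 ^ L * r ^ (L - l))"
    by (subst sum_words_length_le_eq) simp
  also have "\<dots> \<le> (\<Sum>L<l + Suc n. 2 ^ L * r ^ (L - l))"
    using r by (intro sum_mono2) auto
  also have "\<dots> \<le> 2 ^ l + 2 ^ l * (1 / (1 - 2 * r))"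
    unfolding split using r by (intro add_mono mult_left_mono sum_power_le) auto
  finally show ?thesis by (simp add: algebra_simps)
qed

text \<open>A fragment \<open>s\<close> is given the weight \<open>\<theta> * r ^ (length s - l)\<close>, so that the product of the
  weights of an output depends only on its size and its excess.\<close>
lemma card_typical_outputs_le:
  assumes \<theta>: "0 < \<theta>" "\<theta> \<le> 1 / 2" and r: "0 < r" "r < 1 / 2"
  shows "real (card (typical_outputs n l a b)) * (\<theta> powr a * r powr b)
    \<le> exp (2 * \<theta> * 2 ^ l * (1 + 1 / (1 - 2 * r)))"
proof -
  let ?A = "{s :: bool list. length s \<le> n}"
  let ?Y = "typical_outputs n l a b"
  define w where "w s = \<theta> * r ^ (length s - l)" for s :: "bool list"
  have w: "0 \<le> w s" "w s \<le> 1 / 2" for s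
    using mult_mono[of \<theta> "1 / 2" "r ^ (length s - l)" 1] \<theta> r by (auto simp: w_def power_le_one)
  have weight: "(\<Prod>s\<in>#y. w s) = \<theta> powr real (size y) * r powr real (excess l y)" for y
  proof -
    have "(\<Prod>s\<in>#y. w s) = \<theta> ^ size y * r ^ excess l y"
      by (induction y) (auto simp: excess_def w_def power_add)
    then show ?thesis using \<theta> r by (simp add: powr_realpow)
  qed
  have "real (card ?Y) * (\<theta> powr a * r powr b) = (\<Sum>y\<in>?Y. \<theta> powr a * r powr b)" by simp
  also have "\<dots> \<le> (\<Sum>y\<in>?Y. \<Prod>s\<in>#y. w s)"
    unfolding weight using \<theta> r
    by (intro sum_mono mult_mono powr_mono') (auto simp: typical_outputs_def)
  also have "\<dots> \<le> exp (2 * (\<Sum>s\<in>?A. w s))"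
    using w finite_words_length_le finite_typical_outputs
    by (intro sum_prod_mset_le_exp) (auto simp: typical_outputs_def)
  also have "\<dots> \<le> exp (2 * (\<theta> * (2 ^ l * (1 + 1 / (1 - 2 * r)))))"
    using \<theta> sum_fragment_weights_le[OF r, of l n]
    by (simp add: w_def mult_left_mono flip: sum_distrib_left)
  finally show ?thesis by (simp add: mult.assoc)
qed

definition count_exponent :: "real \<Rightarrow> real \<Rightarrow> real \<Rightarrow> real \<Rightarrow> real" where
  "count_exponent \<theta> r a b = 4 * \<theta> * (1 + 1 / (1 - 2 * r)) - a * ln \<theta> - b * ln r"

lemma card_typical_outputs_le_exp:
  assumes \<theta>: "0 < \<theta>" "\<theta> \<le> 1 / 2" and r: "0 < r" "r < 1 / 2" and "0 < n"
  shows "real (card (typical_outputs n (ceillog2 n) (a * real n) (b * real n))) \<le>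
    exp (count_exponent \<theta> r a b * real n)"
proof -
  define C where "C = 1 + 1 / (1 - 2 * r)"
  let ?N = "real (card (typical_outputs n (ceillog2 n) (a * real n) (b * real n)))"
  let ?weight = "\<theta> powr (a * real n) * r powr (b * real n)"
  have "0 \<le> C" using r by (simp add: C_def)
  have "real (2 ^ ceillog2 n) \<le> real (2 * n)"
    using two_power_ceillog2_gt[OF \<open>0 < n\<close>] by (simp only: of_nat_le_iff)
  then have size: "2 * \<theta> * 2 ^ ceillog2 n * C \<le> 4 * \<theta> * C * real n"
    using mult_left_mono[of "2 ^ ceillog2 n" "2 * real n" "2 * \<theta> * C"] \<theta> \<open>0 \<le> C\<close>
    by (simp add: mult_ac)
  have "?N * ?weight \<le> exp (2 * \<theta> * 2 ^ ceillog2 n * C)"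
    unfolding C_def by (intro card_typical_outputs_le \<theta> r)
  also have "\<dots> \<le> exp (4 * \<theta> * C * real n)" using size by simp
  finally have "?N \<le> exp (4 * \<theta> * C * real n) / ?weight"
    using \<theta> r by (simp add: field_simps)
  also have "\<dots> = exp (count_exponent \<theta> r a b * real n)"
    using \<theta> r by (simp add: powr_def count_exponent_def C_def algebra_simps flip: exp_add exp_diff)
  finally show ?thesis .
qed

lemma counting_parameters_exist:
  fixes c R :: real
  assumes "c < R"
  obtains r \<theta> \<delta> :: real where "0 < r" "r < 1 / 2" "0 < \<theta>" "\<theta> \<le> 1 / 2" "0 < \<delta>"
    "count_exponent \<theta> r \<delta> (c + \<delta>) < R * ln 2"
proof -
  have "((\<lambda>r :: real. - c * ln r) \<longlongrightarrow> - c * ln (1 / 2)) (at_left (1 / 2))"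
    by (intro tendsto_intros) auto
  moreover have "- c * ln (1 / 2) < R * ln 2"
    using assms by (simp add: ln_div)
  ultimately have "\<forall>\<^sub>F r in at_left (1 / 2). - c * ln r < R * ln 2 \<and> r \<in> {0<..<1 / 2}"
    by (intro eventually_conj order_tendstoD eventually_at_left_real) auto
  then obtain r where r: "- c * ln r < R * ln 2" "0 < r" "r < 1 / 2"
    by (auto dest!: eventually_happens)
  let ?C = "1 + 1 / (1 - 2 * r)"
  have "((\<lambda>\<theta>. 4 * \<theta> * ?C - c * ln r) \<longlongrightarrow> 4 * 0 * ?C - c * ln r) (at_right 0)"
    by (intro tendsto_intros)
  then have "\<forall>\<^sub>F \<theta> in at_right 0. 4 * \<theta> * ?C - c * ln r < R * ln 2 \<and> \<theta> \<in> {0<..<1 / 2}"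
    using r by (intro eventually_conj order_tendstoD eventually_at_right_real) auto
  then obtain \<theta> where \<theta>: "4 * \<theta> * ?C - c * ln r < R * ln 2" "0 < \<theta>" "\<theta> < 1 / 2"
    by (auto dest!: eventually_happens)
  have "((\<lambda>\<delta>. 4 * \<theta> * ?C - \<delta> * ln \<theta> - (c + \<delta>) * ln r) \<longlongrightarrow>
      4 * \<theta> * ?C - 0 * ln \<theta> - (c + 0) * ln r) (at_right 0)"
    by (intro tendsto_intros)
  then have "\<forall>\<^sub>F \<delta> in at_right 0.
      4 * \<theta> * ?C - \<delta> * ln \<theta> - (c + \<delta>) * ln r < R * ln 2 \<and> \<delta> \<in> {0<..<1}"
    using \<theta> by (intro eventually_conj order_tendstoD eventually_at_right_real) auto
  then obtain \<delta> where "4 * \<theta> * ?C - \<delta> * ln \<theta> - (c + \<delta>) * ln r < R * ln 2" "0 < \<delta>"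
    by (auto dest!: eventually_happens)
  with r \<theta> show thesis by (intro that) (auto simp: count_exponent_def)
qed

lemma card_typical_outputs_negligible:
  fixes c R :: real
  assumes "c < R"
  obtains \<delta> where "0 < \<delta>"
    "(\<lambda>n. real (card (typical_outputs n (ceillog2 n) (\<delta> * real n) ((c + \<delta>) * real n))) /
      2 powr (real n * R)) \<longlonglongrightarrow> 0"
proof -
  obtain r \<theta> \<delta> :: real where r: "0 < r" "r < 1 / 2" and \<theta>: "0 < \<theta>" "\<theta> \<le> 1 / 2" and \<delta>: "0 < \<delta>"
    and less: "count_exponent \<theta> r \<delta> (c + \<delta>) < R * ln 2"
    using counting_parameters_exist[OF assms] by metis
  define \<kappa> where "\<kappa> = count_exponent \<theta> r \<delta> (c + \<delta>)"
  let ?N = "\<lambda>n. real (card (typical_outputs n (ceillog2 n) (\<delta> * real n) ((c + \<delta>) * real n)))"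
  have bound: "?N n / 2 powr (real n * R) \<le> exp ((\<kappa> - R * ln 2) * real n)" if "0 < n" for n
  proof -
    have "?N n / 2 powr (real n * R) \<le> exp (\<kappa> * real n) / 2 powr (real n * R)"
      unfolding \<kappa>_def by (intro divide_right_mono card_typical_outputs_le_exp \<theta> r that) simp
    also have "\<dots> = exp ((\<kappa> - R * ln 2) * real n)"
      by (simp add: powr_def algebra_simps flip: exp_diff)
    finally show ?thesis .
  qed
  have "\<kappa> - R * ln 2 < 0" using less by (simp add: \<kappa>_def)
  then have "(\<lambda>n. exp ((\<kappa> - R * ln 2) * real n)) \<longlonglongrightarrow> 0" by real_asymp
  moreover have "\<forall>\<^sub>F n in sequentially.
      norm (?N n / 2 powr (real n * R)) \<le> exp ((\<kappa> - R * ln 2) * real n)"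
    using eventually_gt_at_top[of 0] by eventually_elim (use bound in simp)
  ultimately have "(\<lambda>n. ?N n / 2 powr (real n * R)) \<longlonglongrightarrow> 0" by (rule Lim_null_comparison[rotated])
  with \<delta> show thesis by (rule that)
qed

section \<open>Concentration of the number of uncut windows\<close>

lemma (in prob_space) variance_sum_indicator_le:
  assumes "finite J" and in_events: "\<And>i. i \<in> J \<Longrightarrow> A i \<in> events"
    and dependent: "\<And>i. i \<in> J \<Longrightarrow> card {j \<in> J. prob (A i \<inter> A j) \<noteq> prob (A i) * prob (A j)} \<le> d"
  shows "variance (\<lambda>\<omega>. \<Sum>i\<in>J. indicator (A i) \<omega>) \<le> real (card J) * real d"
proof -
  let ?X = "\<lambda>\<omega>. \<Sum>i\<in>J. indicator (A i) \<omega> :: real"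
  have expectation: "expectation ?X = (\<Sum>i\<in>J. prob (A i))"
    using in_events by (simp add: emeasure_eq_measure)
  have square: "(?X \<omega>)\<^sup>2 = (\<Sum>i\<in>J. \<Sum>j\<in>J. indicator (A i \<inter> A j) \<omega>)" for \<omega>
    by (simp add: power2_eq_square sum_product indicator_inter_arith)
  have second_moment: "expectation (\<lambda>\<omega>. (?X \<omega>)\<^sup>2) = (\<Sum>i\<in>J. \<Sum>j\<in>J. prob (A i \<inter> A j))"
    unfolding square using in_events by (simp add: emeasure_eq_measure)
  have "variance ?X = expectation (\<lambda>\<omega>. (?X \<omega>)\<^sup>2) - (expectation ?X)\<^sup>2"
  proof (rule variance_eq)
    show "integrable M ?X"
      using in_events by (auto simp: emeasure_eq_measure)
    show "integrable M (\<lambda>\<omega>. (?X \<omega>)\<^sup>2)"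
      unfolding square using in_events by (auto simp: emeasure_eq_measure)
  qed
  also have "\<dots> = (\<Sum>i\<in>J. \<Sum>j\<in>J. prob (A i \<inter> A j) - prob (A i) * prob (A j))"
    unfolding expectation second_moment by (simp add: power2_eq_square sum_product sum_subtractf)
  also have "\<dots> \<le> (\<Sum>i\<in>J. \<Sum>j\<in>J. of_bool (prob (A i \<inter> A j) \<noteq> prob (A i) * prob (A j)))"
    by (intro sum_mono) (auto intro: order_trans[of _ 1] simp: diff_le_eq add_increasing2)
  also have "\<dots> \<le> (\<Sum>i\<in>J. real d)"
    using \<open>finite J\<close> dependent by (intro sum_mono) (simp add: Int_def)
  finally show ?thesis by simp
qed

lemma prob_no_cuts:
  assumes "A \<subseteq> {1..<n}" "0 \<le> q" "q \<le> 1"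
  shows "measure_pmf.prob (cuts_pmf n q) {T. \<forall>i\<in>A. \<not> T i} = (1 - q) ^ card A"
proof -
  let ?B = "\<lambda>i. if i \<in> A then {False} else UNIV"
  have "{T. \<forall>i\<in>A. \<not> T i} = Pi {1..<n} ?B"
    using assms(1) by (auto simp: Pi_def split: if_splits)
  then have "measure_pmf.prob (cuts_pmf n q) {T. \<forall>i\<in>A. \<not> T i} =
      (\<Prod>i\<in>{1..<n}. measure_pmf.prob (bernoulli_pmf q) (?B i))"
    by (simp only: cuts_pmf_def measure_Pi_pmf_Pi finite_atLeastLessThan)
  also have "\<dots> = (\<Prod>i\<in>{1..<n}. if i \<in> A then 1 - q else 1)"
    using assms by (intro prod.cong) (auto simp: measure_pmf_single)
  also have "\<dots> = (1 - q) ^ card A"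
    using assms(1) by (simp add: prod.If_cases Int_absorb1)
  finally show ?thesis .
qed

definition window_uncut :: "nat \<Rightarrow> nat \<Rightarrow> (nat \<Rightarrow> bool) set" where
  "window_uncut l j = {T. \<forall>i\<in>{j<..j + l}. \<not> T i}"

lemma uncut_windows_eq_sum_indicator:
  "real (uncut_windows n l T) = (\<Sum>j<n - l. indicator (window_uncut l j) T)"
  by (simp add: uncut_windows_def window_uncut_def indicator_def Int_def)

lemma prob_window_uncut:
  assumes "0 \<le> q" "q \<le> 1" "j < n - l"
  shows "measure_pmf.prob (cuts_pmf n q) (window_uncut l j) = (1 - q) ^ l"
  unfolding window_uncut_def using assms by (subst prob_no_cuts) auto

lemma prob_disjoint_windows_uncut:
  assumes "0 \<le> q" "q \<le> 1" "i < n - l" "j < n - l" "i + l \<le> j \<or> j + l \<le> i"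
  shows "measure_pmf.prob (cuts_pmf n q) (window_uncut l i \<inter> window_uncut l j) =
    measure_pmf.prob (cuts_pmf n q) (window_uncut l i) *
    measure_pmf.prob (cuts_pmf n q) (window_uncut l j)"
proof -
  let ?I = "{i<..i + l}" and ?J = "{j<..j + l}"
  have "window_uncut l i \<inter> window_uncut l j = {T. \<forall>k\<in>?I \<union> ?J. \<not> T k}"
    by (auto simp: window_uncut_def)
  moreover have "card (?I \<union> ?J) = l + l"
    using assms(5) by (subst card_Un_disjoint) auto
  moreover have "?I \<union> ?J \<subseteq> {1..<n}" using assms by auto
  ultimately show ?thesis
    using assms by (simp add: prob_no_cuts prob_window_uncut power_add)
qed

lemma expectation_uncut_windows:
  assumes "0 \<le> q" "q \<le> 1"
  shows "measure_pmf.expectation (cuts_pmf n q) (\<lambda>T. real (uncut_windows n l T)) =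
    real (n - l) * (1 - q) ^ l"
  using assms
  by (simp add: uncut_windows_eq_sum_indicator measure_pmf.emeasure_eq_measure prob_window_uncut)

lemma variance_uncut_windows_le:
  assumes q: "0 \<le> q" "q \<le> 1"
  shows "measure_pmf.variance (cuts_pmf n q) (\<lambda>T. real (uncut_windows n l T)) \<le>
    real n * real (2 * l)"
proof -
  let ?P = "measure_pmf.prob (cuts_pmf n q)" and ?A = "window_uncut l"
  let ?dependent = "\<lambda>i. {j \<in> {..<n - l}. ?P (?A i \<inter> ?A j) \<noteq> ?P (?A i) * ?P (?A j)}"
  have "measure_pmf.variance (cuts_pmf n q) (\<lambda>T. \<Sum>j<n - l. indicator (?A j) T) \<le>
      real (card {..<n - l}) * real (2 * l)"
  proof (rule measure_pmf.variance_sum_indicator_le)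
    fix i assume i: "i \<in> {..<n - l}"
    have "?dependent i \<subseteq> {i - l..<i + l}"
    proof
      fix j assume "j \<in> ?dependent i"
      then have "\<not> (i + l \<le> j \<or> j + l \<le> i)"
        using i q prob_disjoint_windows_uncut[of q i n l j] by auto
      then show "j \<in> {i - l..<i + l}" by auto
    qed
    then have "card (?dependent i) \<le> card {i - l..<i + l}"
      by (rule card_mono[rotated]) simp
    then show "card (?dependent i) \<le> 2 * l" by simp
  qed simp_all
  also have "\<dots> \<le> real n * real (2 * l)" by (intro mult_right_mono) auto
  finally show ?thesis by (simp add: uncut_windows_eq_sum_indicator)
qed

lemma uncut_windows_le: "uncut_windows n l T \<le> n"
  unfolding uncut_windows_def by (rule order_trans[OF card_mono[of "{..<n - l}"]]) auto

lemma prob_uncut_windows_deviation_le: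
  assumes q: "0 \<le> q" "q \<le> 1" and "0 < t"
  shows "measure_pmf.prob (uncut_windows_pmf n l q) {k. t \<le> \<bar>real k - real (n - l) * (1 - q) ^ l\<bar>} \<le>
    real n * real (2 * l) / t\<^sup>2"
proof -
  let ?D = "cuts_pmf n q" and ?U = "\<lambda>T. real (uncut_windows n l T)"
  have "measure_pmf.prob (uncut_windows_pmf n l q) {k. t \<le> \<bar>real k - real (n - l) * (1 - q) ^ l\<bar>} =
      measure_pmf.prob ?D {T \<in> space ?D. t \<le> \<bar>?U T - measure_pmf.expectation ?D ?U\<bar>}"
    by (simp add: uncut_windows_pmf_def expectation_uncut_windows[OF q] vimage_def)
  also have "\<dots> \<le> measure_pmf.variance ?D ?U / t\<^sup>2"
  proof (rule measure_pmf.Chebyshev_inequality[OF _ _ \<open>0 < t\<close>])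
    show "integrable ?D (\<lambda>T. (?U T)\<^sup>2)"
      by (rule measure_pmf.integrable_const_bound[where B = "(real n)\<^sup>2"])
        (auto intro!: AE_pmfI power_mono simp: uncut_windows_le)
  qed simp
  also have "\<dots> \<le> real n * real (2 * l) / t\<^sup>2"
    by (intro divide_right_mono variance_uncut_windows_le q) simp
  finally show ?thesis .
qed

lemma mean_uncut_windows_tendsto:
  fixes p :: "nat \<Rightarrow> real" and l :: "nat \<Rightarrow> nat"
  assumes sublinear: "(\<lambda>n. real (l n) / real n) \<longlonglongrightarrow> 0" and limit: "(\<lambda>n. (1 - p n) ^ l n) \<longlonglongrightarrow> c"
  shows "(\<lambda>n. real (n - l n) * (1 - p n) ^ l n / real n) \<longlonglongrightarrow> c"
proof -
  have "(\<lambda>n. (1 - real (l n) / real n) * (1 - p n) ^ l n) \<longlonglongrightarrow> (1 - 0) * c"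
    by (intro tendsto_intros sublinear limit)
  moreover have "\<forall>\<^sub>F n in sequentially. (1 - real (l n) / real n) * (1 - p n) ^ l n =
      real (n - l n) * (1 - p n) ^ l n / real n"
    using order_tendstoD(2)[OF sublinear, of 1, simplified] eventually_gt_at_top[of 0]
    by eventually_elim (simp add: of_nat_diff field_simps)
  ultimately have "(\<lambda>n. real (n - l n) * (1 - p n) ^ l n / real n) \<longlonglongrightarrow> (1 - 0) * c"
    by (rule Lim_transform_eventually)
  then show ?thesis by simp
qed

lemma window_deviation_le:
  assumes "0 \<le> q" "q \<le> 1" "0 < \<delta>" "0 < n"
    and mean: "\<bar>real (n - l) * (1 - q) ^ l / real n - c\<bar> < \<delta> / 2"
  shows "window_deviation n l q c \<delta> \<le> 8 / \<delta>\<^sup>2 * (real l / real n)"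
proof -
  let ?P = "measure_pmf.prob (uncut_windows_pmf n l q)"
  define \<mu> where "\<mu> = real (n - l) * (1 - q) ^ l"
  have "\<bar>\<mu> / real n - c\<bar> * real n < \<delta> / 2 * real n"
    using mean \<open>0 < n\<close> unfolding \<mu>_def by (intro mult_strict_right_mono) auto
  then have "\<bar>\<mu> - c * real n\<bar> < \<delta> * real n / 2"
    using \<open>0 < n\<close> by (simp add: abs_mult_pos left_diff_distrib)
  then have "{k. \<delta> * real n \<le> \<bar>real k - c * real n\<bar>} \<subseteq> {k. \<delta> * real n / 2 \<le> \<bar>real k - \<mu>\<bar>}"
    by (intro Collect_mono impI) linarith
  then have "window_deviation n l q c \<delta> \<le> ?P {k. \<delta> * real n / 2 \<le> \<bar>real k - \<mu>\<bar>}"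
    unfolding window_deviation_def by (intro measure_pmf.finite_measure_mono) auto
  also have "\<dots> \<le> real n * real (2 * l) / (\<delta> * real n / 2)\<^sup>2"
    unfolding \<mu>_def using assms by (intro prob_uncut_windows_deviation_le) auto
  also have "\<dots> = 8 / \<delta>\<^sup>2 * (real l / real n)"
    using assms by (simp add: field_simps power2_eq_square)
  finally show ?thesis .
qed

lemma window_deviation_tendsto_0:
  fixes p :: "nat \<Rightarrow> real" and l :: "nat \<Rightarrow> nat"
  assumes bounds: "\<forall>\<^sub>F n in sequentially. 0 \<le> p n \<and> p n \<le> 1"
    and sublinear: "(\<lambda>n. real (l n) / real n) \<longlonglongrightarrow> 0"
    and limit: "(\<lambda>n. (1 - p n) ^ l n) \<longlonglongrightarrow> c" and "0 < \<delta>"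
  shows "(\<lambda>n. window_deviation n (l n) (p n) c \<delta>) \<longlonglongrightarrow> 0"
proof (rule tendsto_sandwich[where f = "\<lambda>_. 0"])
  have "\<forall>\<^sub>F n in sequentially. dist (real (n - l n) * (1 - p n) ^ l n / real n) c < \<delta> / 2"
    using mean_uncut_windows_tendsto[OF sublinear limit] \<open>0 < \<delta>\<close> by (intro tendstoD) auto
  then show "\<forall>\<^sub>F n in sequentially.
      window_deviation n (l n) (p n) c \<delta> \<le> 8 / \<delta>\<^sup>2 * (real (l n) / real n)"
    using eventually_gt_at_top[of 0] bounds
    by eventually_elim (intro window_deviation_le, auto simp: dist_real_def \<open>0 < \<delta>\<close>)
  show "(\<lambda>n. 8 / \<delta>\<^sup>2 * (real (l n) / real n)) \<longlonglongrightarrow> 0"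
    using tendsto_mult_left[OF sublinear, of "8 / \<delta>\<^sup>2"] by simp
qed (simp_all add: window_deviation_def)

section \<open>Capacity\<close>

lemma tendsto_power_one_minus:
  fixes x :: "'i \<Rightarrow> real" and k :: "'i \<Rightarrow> nat"
  assumes x: "filterlim x (at_right 0) F" and xk: "((\<lambda>i. x i * real (k i)) \<longlongrightarrow> a) F"
  shows "((\<lambda>i. (1 - x i) ^ k i) \<longlongrightarrow> exp (- a)) F"
proof -
  have "((\<lambda>t :: real. ln (1 - t) / t) \<longlongrightarrow> - 1) (at_right 0)" by real_asymp
  then have "((\<lambda>i. ln (1 - x i) / x i) \<longlongrightarrow> - 1) F"
    using x by (rule filterlim_compose)
  then have "((\<lambda>i. exp (x i * real (k i) * (ln (1 - x i) / x i))) \<longlongrightarrow> exp (a * (- 1))) F"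
    by (intro tendsto_intros xk)
  moreover have "\<forall>\<^sub>F t in at_right (0 :: real). t \<in> {0<..<1}"
    by (rule eventually_at_right_real) simp
  then have "\<forall>\<^sub>F i in F. x i \<in> {0<..<1}"
    using x by (rule eventually_compose_filterlim)
  then have "\<forall>\<^sub>F i in F. exp (x i * real (k i) * (ln (1 - x i) / x i)) = (1 - x i) ^ k i"
    by eventually_elim (simp add: exp_of_nat_mult)
  ultimately show ?thesis by (simp add: tendsto_cong)
qed

lemma eventually_log_pos: "\<forall>\<^sub>F n in sequentially. 0 < log 2 (real n)"
  by real_asymp

lemma ceillog2_over_log_tendsto: "(\<lambda>n. real (ceillog2 n) / log 2 (real n)) \<longlonglongrightarrow> 1"
proof (rule tendsto_sandwich)
  show "\<forall>\<^sub>F n in sequentially. 1 \<le> real (ceillog2 n) / log 2 (real n)"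
    using eventually_log_pos eventually_gt_at_top[of 0]
    by eventually_elim (simp add: ceillog2_ge_log)
  show "\<forall>\<^sub>F n in sequentially.
      real (ceillog2 n) / log 2 (real n) \<le> (log 2 (real n) + 1) / log 2 (real n)"
    using eventually_log_pos eventually_gt_at_top[of 0]
    by eventually_elim (intro divide_right_mono less_imp_le ceillog2_less_log)
  show "(\<lambda>n. (log 2 (real n) + 1) / log 2 (real n)) \<longlonglongrightarrow> 1" by real_asymp
qed simp

lemma ceillog2_over_n_tendsto: "(\<lambda>n. real (ceillog2 n) / real n) \<longlonglongrightarrow> 0"
proof -
  have "(\<lambda>n. log 2 (real n) / real n) \<longlonglongrightarrow> 0" by real_asymp
  with ceillog2_over_log_tendsto
  have "(\<lambda>n. real (ceillog2 n) / log 2 (real n) * (log 2 (real n) / real n)) \<longlonglongrightarrow> 1 * 0"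
    by (rule tendsto_mult)
  moreover have "\<forall>\<^sub>F n in sequentially.
      real (ceillog2 n) / log 2 (real n) * (log 2 (real n) / real n) = real (ceillog2 n) / real n"
    using eventually_log_pos by eventually_elim simp
  ultimately have "(\<lambda>n. real (ceillog2 n) / real n) \<longlonglongrightarrow> 1 * 0"
    by (rule Lim_transform_eventually)
  then show ?thesis by simp
qed

lemma code_error_nonneg: "0 \<le> code_error q M enc dec"
  by (simp add: code_error_def sum_nonneg)

locale torn_paper_regime =
  fixes p :: "nat \<Rightarrow> real" and \<alpha> :: real
  assumes p_bounds: "\<And>n. n \<ge> 1 \<Longrightarrow> 0 < p n \<and> p n < 1"
    and p_log: "(\<lambda>n. p n * log 2 (real n)) \<longlonglongrightarrow> \<alpha>"
begin

lemma p_at_right_0: "filterlim p (at_right 0) sequentially"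
proof (rule tendsto_imp_filterlim_at_right)
  have "filterlim (\<lambda>n. log 2 (real n)) at_top sequentially" by real_asymp
  then have "(\<lambda>n. p n * log 2 (real n) / log 2 (real n)) \<longlonglongrightarrow> 0"
    by (rule real_tendsto_divide_at_top[OF p_log])
  moreover have "\<forall>\<^sub>F n in sequentially. p n * log 2 (real n) / log 2 (real n) = p n"
    using eventually_log_pos by eventually_elim simp
  ultimately show "p \<longlonglongrightarrow> 0" by (rule Lim_transform_eventually)
  show "\<forall>\<^sub>F n in sequentially. 0 < p n"
    using eventually_ge_at_top[of 1] by eventually_elim (simp add: p_bounds)
qed

lemma p_ceillog2_tendsto: "(\<lambda>n. p n * real (ceillog2 n)) \<longlonglongrightarrow> \<alpha>"
proof -
  have "(\<lambda>n. p n * log 2 (real n) * (real (ceillog2 n) / log 2 (real n))) \<longlonglongrightarrow> \<alpha> * 1"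
    by (intro tendsto_mult p_log ceillog2_over_log_tendsto)
  moreover have "\<forall>\<^sub>F n in sequentially.
      p n * log 2 (real n) * (real (ceillog2 n) / log 2 (real n)) = p n * real (ceillog2 n)"
    using eventually_log_pos by eventually_elim simp
  ultimately have "(\<lambda>n. p n * real (ceillog2 n)) \<longlonglongrightarrow> \<alpha> * 1"
    by (rule Lim_transform_eventually)
  then show ?thesis by simp
qed

lemma eventually_p_bounds: "\<forall>\<^sub>F n in sequentially. 0 \<le> p n \<and> p n \<le> 1"
  using eventually_ge_at_top[of 1] by eventually_elim (simp add: p_bounds less_imp_le)

lemma excess_deviation_tendsto_0:
  assumes "0 < \<delta>"
  shows "(\<lambda>n. window_deviation n (ceillog2 n) (p n) (exp (- \<alpha>)) \<delta>) \<longlonglongrightarrow> 0"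
  by (intro window_deviation_tendsto_0 eventually_p_bounds ceillog2_over_n_tendsto
      tendsto_power_one_minus p_at_right_0 p_ceillog2_tendsto assms)

lemma fragment_number_deviation_tendsto_0:
  assumes "0 < \<delta>"
  shows "(\<lambda>n. window_deviation n 1 (p n) 1 \<delta>) \<longlonglongrightarrow> 0"
proof (rule window_deviation_tendsto_0[OF eventually_p_bounds _ _ assms])
  have "p \<longlonglongrightarrow> 0" using p_at_right_0 by (simp add: filterlim_at)
  then have "(\<lambda>n. 1 - p n) \<longlonglongrightarrow> 1 - 0" by (intro tendsto_intros)
  then show "(\<lambda>n. (1 - p n) ^ 1) \<longlonglongrightarrow> 1" by simp
  show "(\<lambda>n. real 1 / real n) \<longlonglongrightarrow> 0" by real_asymp
qed

lemma achievable_if_less_exp: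
  assumes R: "0 \<le> R" "R < exp (- \<alpha>)"
  shows "achievable p R"
proof -
  define \<delta> where "\<delta> = (exp (- \<alpha>) - R) / 2"
  have \<delta>: "0 < \<delta>" "R + 2 * \<delta> \<le> exp (- \<alpha>)" using R by (simp_all add: \<delta>_def field_simps)
  let ?err = "\<lambda>n c. code_error (p n) (num_msgs n R) (fst c) (snd c)"
  let ?bound = "\<lambda>n. window_deviation n (ceillog2 n) (p n) (exp (- \<alpha>)) \<delta> + 2 * 2 powr (- \<delta> * real n)"
  have "\<forall>n. \<exists>c. c \<in> codes n (num_msgs n R) \<and> ?err n c \<le> ?bound n"
    using good_code_of_rate_exists[OF le_two_power_ceillog2 R(1) \<delta>(2)] by blast
  then obtain code where code: "\<And>n. code n \<in> codes n (num_msgs n R)"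
    and err: "\<And>n. ?err n (code n) \<le> ?bound n"
    by metis
  have "(\<lambda>n. 2 * 2 powr (- \<delta> * real n)) \<longlonglongrightarrow> 0" using \<delta>(1) by real_asymp
  with excess_deviation_tendsto_0[OF \<delta>(1)] have "?bound \<longlonglongrightarrow> 0" by (rule tendsto_add_zero)
  moreover have "norm (?err n (code n)) \<le> ?bound n" for n
    using err[of n] by (simp add: code_error_nonneg)
  ultimately have "(\<lambda>n. ?err n (code n)) \<longlonglongrightarrow> 0"
    by (rule Lim_null_comparison[OF always_eventually[OF allI], rotated])
  with code show ?thesis unfolding achievable_def by blast
qed

lemma achievable_imp_le_exp:
  assumes "achievable p R"
  shows "R \<le> exp (- \<alpha>)"
proof (rule ccontr)
  let ?c = "exp (- \<alpha>)"
  assume "\<not> R \<le> ?c"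
  then have "?c < R" by simp
  then obtain \<delta> where \<delta>: "0 < \<delta>"
    and negligible: "(\<lambda>n. real (card (typical_outputs n (ceillog2 n) (\<delta> * real n)
      ((?c + \<delta>) * real n))) / 2 powr (real n * R)) \<longlonglongrightarrow> 0" (is "?ratio \<longlonglongrightarrow> 0")
    by (rule card_typical_outputs_negligible)
  obtain code where code: "\<And>n. code n \<in> codes n (num_msgs n R)"
    and err: "(\<lambda>n. code_error (p n) (num_msgs n R) (fst (code n)) (snd (code n))) \<longlonglongrightarrow> 0"
      (is "?err \<longlonglongrightarrow> 0")
    using assms unfolding achievable_def by blast
  let ?bound = "\<lambda>n. window_deviation n 1 (p n) 1 \<delta> +
    window_deviation n (ceillog2 n) (p n) ?c \<delta> + ?ratio n"
  have "?bound \<longlonglongrightarrow> 0"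
    by (intro tendsto_add_zero fragment_number_deviation_tendsto_0 excess_deviation_tendsto_0
        negligible \<delta>)
  moreover have "(\<lambda>n. 1 - ?err n) \<longlonglongrightarrow> 1 - 0"
    by (intro tendsto_diff tendsto_const err)
  moreover have "1 - ?err n \<le> ?bound n" for n
    by (rule converse_bound_of_rate[OF code])
  ultimately have "1 - 0 \<le> (0 :: real)"
    by (intro LIMSEQ_le) auto
  then show False by simp
qed

end

theorem theorem1:
  fixes p :: "nat \<Rightarrow> real" and \<alpha> :: real
  assumes "\<And>n. n \<ge> 1 \<Longrightarrow> 0 < p n \<and> p n < 1"
    and "(\<lambda>n. p n * log 2 (real n)) \<longlonglongrightarrow> \<alpha>"
  shows "capacity p = exp (- \<alpha>)"
proof -
  interpret torn_paper_regime p \<alpha>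
    by unfold_locales (fact assms)+
  show ?thesis
    unfolding capacity_def
  proof (rule cSup_eq_non_empty)
    show "{R. 0 \<le> R \<and> achievable p R} \<noteq> {}"
      using achievable_if_less_exp[of 0] by auto
    show "R \<le> exp (- \<alpha>)" if "R \<in> {R. 0 \<le> R \<and> achievable p R}" for R
      using that achievable_imp_le_exp by simp
    show "exp (- \<alpha>) \<le> B" if upper: "\<And>R. R \<in> {R. 0 \<le> R \<and> achievable p R} \<Longrightarrow> R \<le> B" for B
    proof (rule dense_le_bounded[of 0])
      show "R \<le> B" if "0 < R" "R < exp (- \<alpha>)" for R
        using upper achievable_if_less_exp[of R] that by simp
    qed simp
  qed
qed

end
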